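(* Let $T:X\to X$ be a map on a set with $f_n=f_n(T)$ finite for all $n\ge1$, and let $f^*_n=f^*_n(T)$. Let $C$ and $\alpha$ be positive real constants. (1) If $\alpha>1$, then the set $\left\{\frac{f^*_n}{n^{\alpha}}\mid n\ge1\right\}$ is bounded if and only if the set $\left\{\frac{f_n}{n^{\alpha}}\mid n\ge1\right\}$ is bounded. (2) If $\alpha>1$, then $\frac{f_n}{n^{\alpha}}\to0$ as $n\to\infty$ if and only if $\frac{f^*_n}{n^{\alpha}}\to0$ as $n\to\infty$. (3) If $\frac{f_n}{n^{\alpha}}\to C$ as $n\to\infty$ for some $\alpha>1$, then the sequence $\left(\frac{f^*_n}{n^{\alpha}}\right)_{n\ge1}$ has infinitely many limit points. (4) If $\frac{f^*_n}{n^{\alpha}}\to C$ as $n\to\infty$ for some $\alpha\ge1$, then the sequence $\left(\frac{f_n}{n^{\alpha}}\right)_{n\ge1}$ has infinitely many limit points.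
   Context: For a map $T:X\to X$ on a set $X$ and $n\ge1$, $f_n(T)=\#\{x\in X\mid T^nx=x\}$ is the number of points with period $n$, and $f^*_n(T)$ is the number of points with least period $n$, i.e. the number of $x\in X$ with $T^nx=x$ whose orbit under $T$ has exactly $n$ elements. A limit point of a sequence is a real number that is the limit of some subsequence. *)

theory Defs
  imports "HOL-Analysis.Analysis"
begin

definition period_points :: "'a set \<Rightarrow> ('a \<Rightarrow> 'a) \<Rightarrow> nat \<Rightarrow> 'a set" where
  "period_points X T n = {x \<in> X. (T ^^ n) x = x}"

text \<open>The forward orbit includes the point itself.\<close>

definition forward_orbit :: "('a \<Rightarrow> 'a) \<Rightarrow> 'a \<Rightarrow> 'a set" where
  "forward_orbit T x = {(T ^^ k) x | k. True}"

text \<open>The next two counts are cardinalities, hence meaningful only if the sets are finite.\<close>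

definition num_period :: "'a set \<Rightarrow> ('a \<Rightarrow> 'a) \<Rightarrow> nat \<Rightarrow> nat" where
  "num_period X T n = card (period_points X T n)"

definition num_least_period :: "'a set \<Rightarrow> ('a \<Rightarrow> 'a) \<Rightarrow> nat \<Rightarrow> nat" where
  "num_least_period X T n = card {x \<in> period_points X T n. card (forward_orbit T x) = n}"

text \<open>Limits of subsequences of a sequence indexed from 1; the value at index 0 is ignored.\<close>

definition limit_points :: "(nat \<Rightarrow> real) \<Rightarrow> real set" where
  "limit_points a = {L. \<exists>r. strict_mono r \<and> (\<forall>k. 1 \<le> r k) \<and> (\<lambda>k. a (r k)) \<longlonglongrightarrow> L}"

end

theory Submission
  imports Defs "HOL-Computational_Algebra.Primes"
begin

text \<open>
  A point fixed by \<open>T ^^ n\<close> has a least period dividing \<open>n\<close>, so the two counts are related by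
  \<open>f n = (\<Sum>d | d dvd n. g d)\<close>, where \<open>f\<close> counts points of period \<open>n\<close> and \<open>g\<close> those of least
  period \<open>n\<close> (lemma \<open>num_period_eq_sum_divisors\<close>). Everything else is
  about two sequences of naturals linked by this divisor sum.

  Since \<open>g \<le> f\<close>, boundedness and convergence to zero pass from \<open>f\<close> to \<open>g\<close>. For the other direction,
  writing divisors as \<open>d = n div e\<close> turns the normalised relation into a weighted sum,
  \<open>f n / n powr \<alpha> = (\<Sum>e | e dvd n. (g (n div e) / (n div e) powr \<alpha>) * e powr - \<alpha>)\<close>,
  whose weights are summable over all \<open>e\<close> exactly because \<open>\<alpha> > 1\<close>. A bound on the normalised
  \<open>g\<close> therefore bounds the normalised \<open>f\<close> (\<open>divisor_sum_ratio_bound\<close>), and dominated convergence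
  for series transports a zero limit (\<open>divisor_sum_ratio_tendsto_0\<close>).

  If one of the sequences has a nonzero normalised limit \<open>C\<close>, it suffices to look at the other one
  along \<open>n = q * p\<close> with \<open>q\<close> a fixed prime and \<open>p\<close> running through the larger primes. There the
  divisor sum has only four terms, and \<open>f p = g 1 + g p\<close>, so that
  \<open>f (q * p) = g 1 + g p + g q + g (q * p)\<close> and \<open>g (q * p) = f (q * p) - f p - g q\<close>. After
  dividing by \<open>(q * p) powr \<alpha>\<close> the terms at \<open>q * p\<close> tend to \<open>C\<close>, those at \<open>p\<close> to
  \<open>C * q powr - \<alpha>\<close>, and the remaining ones to zero. Thus \<open>C * (1 + q powr - \<alpha>)\<close> is a limit point for
  \<open>f\<close>, respectively \<open>C * (1 - q powr - \<alpha>)\<close> for \<open>g\<close>, and different primes \<open>q\<close> give different values.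
\<close>

section \<open>Counting periodic points over divisors\<close>

text \<open>
  With \<open>d\<close> the least positive return time of \<open>x\<close>, the points \<open>(T ^^ k) x\<close> for \<open>k < d\<close> are distinct and
  exhaust the orbit, so the orbit has exactly \<open>d\<close> elements. Reducing any other return time modulo \<open>d\<close>
  gives a return time below \<open>d\<close>, which must be zero.
\<close>

lemma least_period_properties:
  assumes "(T ^^ n) x = x" and "n \<ge> 1"
  shows "(T ^^ card (forward_orbit T x)) x = x" and "card (forward_orbit T x) dvd n"
proof -
  define d where "d = (LEAST m. m \<ge> 1 \<and> (T ^^ m) x = x)"
  have d: "d \<ge> 1 \<and> (T ^^ d) x = x"
    unfolding d_def by (rule LeastI [of _ n]) (use assms in auto)
  have least: "m = 0" if "m < d" "(T ^^ m) x = x" for m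
    using not_less_Least [OF that(1) [unfolded d_def]] that(2) by (simp add: Suc_le_eq)
  have orbit: "forward_orbit T x = (\<lambda>k. (T ^^ k) x) ` {..<d}"
  proof
    show "forward_orbit T x \<subseteq> (\<lambda>k. (T ^^ k) x) ` {..<d}"
    proof
      fix y assume "y \<in> forward_orbit T x"
      then obtain k where "y = (T ^^ k) x"
        by (auto simp: forward_orbit_def)
      then have "y = (T ^^ (k mod d)) x"
        using d by (simp add: funpow_mod_eq)
      then show "y \<in> (\<lambda>k. (T ^^ k) x) ` {..<d}"
        using d by auto
    qed
  qed (auto simp: forward_orbit_def)
  have neq: "(T ^^ i) x \<noteq> (T ^^ j) x" if "i < j" "j < d" for i j
  proof
    assume eq: "(T ^^ i) x = (T ^^ j) x"
    \<comment> \<open>Pushing a collision forward to time \<open>d\<close> produces a return to \<open>x\<close> before \<open>d\<close>.\<close>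
    have "(T ^^ (d - j + i)) x = (T ^^ (d - j + j)) x"
      by (simp only: funpow_add o_apply eq)
    also have "\<dots> = x"
      using that d by simp
    finally have "d - j + i = 0"
      using that by (intro least) linarith
    then show False
      using that by simp
  qed
  have "inj_on (\<lambda>k. (T ^^ k) x) {..<d}"
    by (rule linorder_inj_onI) (use neq in auto)
  then have card: "card (forward_orbit T x) = d"
    by (simp add: orbit card_image)
  show "(T ^^ card (forward_orbit T x)) x = x"
    using d card by simp
  have "(T ^^ (n mod d)) x = x"
    using d assms by (simp add: funpow_mod_eq)
  then have "n mod d = 0"
    using d by (intro least) simp_all
  then show "card (forward_orbit T x) dvd n"
    using card by auto
qed

lemma num_period_eq_sum_divisors:
  assumes fin: "\<And>n. n \<ge> 1 \<Longrightarrow> finite (period_points X T n)" and "n \<ge> 1"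
  shows "num_period X T n = (\<Sum>d | d dvd n. num_least_period X T d)"
proof -
  let ?L = "\<lambda>d. {x \<in> period_points X T d. card (forward_orbit T x) = d}"
  have "period_points X T n = (\<Union>d\<in>{d. d dvd n}. ?L d)"
  proof
    show "period_points X T n \<subseteq> (\<Union>d\<in>{d. d dvd n}. ?L d)"
    proof
      fix x assume x: "x \<in> period_points X T n"
      then have "(T ^^ n) x = x"
        by (simp add: period_points_def)
      from least_period_properties [OF this \<open>n \<ge> 1\<close>]
      show "x \<in> (\<Union>d\<in>{d. d dvd n}. ?L d)"
        using x by (intro UN_I [of "card (forward_orbit T x)"]) (simp_all add: period_points_def)
    qed
    show "(\<Union>d\<in>{d. d dvd n}. ?L d) \<subseteq> period_points X T n"
    proof clarify
      fix d x assume "d dvd n" "x \<in> period_points X T d"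
      then show "x \<in> period_points X T n"
        using funpow_mod_eq [where f = T and n = d and m = n and x = x]
        by (simp add: period_points_def)
    qed
  qed
  then have "num_period X T n = card (\<Union>d\<in>{d. d dvd n}. ?L d)"
    by (simp add: num_period_def)
  also have "\<dots> = (\<Sum>d | d dvd n. card (?L d))"
  proof (rule card_UN_disjoint)
    show "\<forall>d\<in>{d. d dvd n}. finite (?L d)"
    proof
      fix d assume "d \<in> {d. d dvd n}"
      then have "d \<ge> 1"
        using \<open>n \<ge> 1\<close> by (cases d) auto
      then show "finite (?L d)"
        using fin by simp
    qed
  qed (use \<open>n \<ge> 1\<close> in auto)
  finally show ?thesis
    by (simp add: num_least_period_def)
qed

section \<open>Growth of divisor sums\<close>

text \<open>
  Putting the complementary divisor \<open>e\<close> in front isolates weights \<open>e powr - \<alpha>\<close> that do not depend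
  on \<open>n\<close>. The sum is stated as a series over all \<open>e\<close> so that it can be compared with, and passed to
  the limit under, the convergent series of the weights. The term at \<open>e = 0\<close> vanishes since \<open>0\<close> does
  not divide \<open>n\<close>.
\<close>

lemma divisor_sum_ratio_eq_suminf:
  fixes f g :: "nat \<Rightarrow> nat"
  assumes fg: "f n = (\<Sum>d | d dvd n. g d)" and n: "n \<ge> 1"
  shows "real (f n) / real n powr \<alpha> =
    (\<Sum>e. if e dvd n then real (g (n div e)) / real (n div e) powr \<alpha> * real e powr - \<alpha> else 0)"
proof -
  have "real (f n) / real n powr \<alpha> = (\<Sum>d | d dvd n. real (g d) / real n powr \<alpha>)"
    by (simp add: fg sum_divide_distrib)
  also have "\<dots> = (\<Sum>e | e dvd n. real (g (n div e)) / real n powr \<alpha>)"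
    by (rule sum.reindex_bij_witness [of _ "\<lambda>e. n div e" "\<lambda>d. n div d"]) (use n in auto)
  also have "\<dots> = (\<Sum>e | e dvd n.
      real (g (n div e)) / real (n div e) powr \<alpha> * real e powr - \<alpha>)"
  proof (rule sum.cong [OF refl])
    fix e assume "e \<in> {e. e dvd n}"
    then have "real n = real (n div e) * real e"
      by (simp flip: of_nat_mult)
    then have "real n powr \<alpha> = real (n div e) powr \<alpha> * real e powr \<alpha>"
      by (simp add: powr_mult)
    then show "real (g (n div e)) / real n powr \<alpha> =
        real (g (n div e)) / real (n div e) powr \<alpha> * real e powr - \<alpha>"
      by (simp add: powr_minus divide_simps)
  qed
  also have "\<dots> = (\<Sum>e | e dvd n. if e dvd n
      then real (g (n div e)) / real (n div e) powr \<alpha> * real e powr - \<alpha> else 0)"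
    by simp
  also have "\<dots> = (\<Sum>e. if e dvd n
      then real (g (n div e)) / real (n div e) powr \<alpha> * real e powr - \<alpha> else 0)"
    by (rule suminf_finite [symmetric]) (use n in auto)
  finally show ?thesis .
qed

lemma summable_nat_powr_minus:
  assumes "\<alpha> > 1"
  shows "summable (\<lambda>e. real e powr - \<alpha>)"
  using assms by (simp add: summable_real_powr_iff)

lemma divisor_sum_ratio_bound:
  fixes f g :: "nat \<Rightarrow> nat"
  assumes fg: "f n = (\<Sum>d | d dvd n. g d)" and n: "n \<ge> 1" and "\<alpha> > 1"
    and B: "\<And>m. m \<ge> 1 \<Longrightarrow> real (g m) / real m powr \<alpha> \<le> B" and "B \<ge> 0"
  shows "real (f n) / real n powr \<alpha> \<le> B * (\<Sum>e. real e powr - \<alpha>)"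
proof -
  have sm: "summable (\<lambda>e. B * real e powr - \<alpha>)"
    by (intro summable_mult summable_nat_powr_minus \<open>\<alpha> > 1\<close>)
  have "(if e dvd n then real (g (n div e)) / real (n div e) powr \<alpha> * real e powr - \<alpha> else 0)
      \<le> B * real e powr - \<alpha>" for e
  proof (cases "e dvd n")
    case True
    then have "n div e \<ge> 1"
      using n by (auto elim!: dvdE)
    then show ?thesis
      using True by (simp only: if_True) (intro mult_right_mono B powr_ge_zero)
  next
    case False
    then show ?thesis
      using \<open>B \<ge> 0\<close> by simp
  qed
  then have "real (f n) / real n powr \<alpha> \<le> (\<Sum>e. B * real e powr - \<alpha>)"
    unfolding divisor_sum_ratio_eq_suminf [of f, OF fg n]
    by (intro suminf_le sm summable_finite [of "{e. e dvd n}"]) (use n in auto)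
  also have "\<dots> = B * (\<Sum>e. real e powr - \<alpha>)"
    by (intro suminf_mult summable_nat_powr_minus \<open>\<alpha> > 1\<close>)
  finally show ?thesis .
qed

text \<open>
  Each term of the series in \<open>divisor_sum_ratio_eq_suminf\<close> tends to zero, because
  \<open>n div e\<close> tends to infinity for fixed \<open>e > 0\<close>, and it is dominated by a constant times the summable
  \<open>e powr - \<alpha>\<close>. Tannery's theorem then exchanges limit and sum.
\<close>

lemma divisor_sum_ratio_tendsto_0:
  fixes f g :: "nat \<Rightarrow> nat"
  assumes fg: "\<And>n. n \<ge> 1 \<Longrightarrow> f n = (\<Sum>d | d dvd n. g d)" and "\<alpha> > 1"
    and lim: "(\<lambda>n. real (g n) / real n powr \<alpha>) \<longlonglongrightarrow> 0"
  shows "(\<lambda>n. real (f n) / real n powr \<alpha>) \<longlonglongrightarrow> 0"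
proof -
  define b where "b n = real (g n) / real n powr \<alpha>" for n
  define t where "t e n = (if e dvd n then b (n div e) * real e powr - \<alpha> else 0)" for e n
  obtain B where B: "\<And>n. norm (b n) \<le> B"
    using convergent_imp_Bseq [OF convergentI [OF lim]] by (auto simp: Bseq_def b_def)
  have "B \<ge> 0"
    using B [of 0] norm_ge_zero order_trans by blast
  \<comment> \<open>At \<open>e = 0\<close>, where \<open>n div 0 = 0\<close> does not tend to infinity, the weight \<open>0 powr - \<alpha> = 0\<close> kills the term.\<close>
  have "t e \<longlonglongrightarrow> 0" for e
  proof (cases "e = 0")
    case True
    then have "t e = (\<lambda>n. 0)"
      by (auto simp: t_def)
    then show ?thesis
      by simp
  next
    case False
    have "filterlim (\<lambda>n. n div e) sequentially sequentially"
      using False by (intro filterlim_at_top_div_const_nat) simp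
    then have "(\<lambda>n. b (n div e)) \<longlonglongrightarrow> 0"
      using lim filterlim_compose unfolding b_def by blast
    then have "(\<lambda>n. b (n div e) * real e powr - \<alpha>) \<longlonglongrightarrow> 0"
      by (rule tendsto_mult_left_zero)
    then show ?thesis
      by (rule Lim_null_comparison [rotated, OF tendsto_norm_zero])
        (simp add: t_def)
  qed
  moreover have "eventually (\<lambda>(e, n). norm (t e n) \<le> B * real e powr - \<alpha>)
      (sequentially \<times>\<^sub>F sequentially)"
    using B \<open>B \<ge> 0\<close> by (intro always_eventually) (auto simp: t_def abs_mult intro!: mult_right_mono)
  moreover have "summable (\<lambda>e. B * real e powr - \<alpha>)"
    by (intro summable_mult summable_nat_powr_minus \<open>\<alpha> > 1\<close>)
  ultimately have "(\<lambda>n. \<Sum>e. t e n) \<longlonglongrightarrow> (\<Sum>e. 0)"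
    using tannerys_theorem [of t "\<lambda>_. 0" sequentially "\<lambda>e. B * real e powr - \<alpha>"] by simp
  then have "(\<lambda>n. \<Sum>e. t e n) \<longlonglongrightarrow> 0"
    by simp
  moreover have "eventually (\<lambda>n. (\<Sum>e. t e n) = real (f n) / real n powr \<alpha>) sequentially"
    using eventually_ge_at_top [of 1]
    unfolding t_def b_def by eventually_elim (rule divisor_sum_ratio_eq_suminf [OF fg, symmetric])
  ultimately show ?thesis
    by (rule Lim_transform_eventually)
qed

section \<open>Limit points along products of two primes\<close>

lemma divisors_of_two_primes:
  fixes p q :: nat
  assumes "prime p" "prime q"
  shows "{d. d dvd q * p} = {1, p, q, q * p}"
proof -
  have "d = 1 \<or> d = p \<or> d = q \<or> d = q * p" if d: "d dvd q * p" for d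
  proof -
    obtain a b where "d = a * b" "a dvd q" "b dvd p"
      using division_decomp [OF d] by blast
    moreover have "a = 1 \<or> a = q" "b = 1 \<or> b = p"
      using assms \<open>a dvd q\<close> \<open>b dvd p\<close> unfolding prime_nat_iff by blast+
    ultimately show ?thesis
      by auto
  qed
  then show ?thesis
    by auto
qed

lemma divisor_sum_two_primes:
  fixes f g :: "nat \<Rightarrow> nat"
  assumes fg: "\<And>n. n \<ge> 1 \<Longrightarrow> f n = (\<Sum>d | d dvd n. g d)"
    and "prime p" "prime q" "p \<noteq> q"
  shows "f (q * p) = g 1 + g p + g q + g (q * p)" and "f p = g 1 + g p"
proof -
  have *: "p \<noteq> 1" "q \<noteq> 1" "p > 1" "q > 1" "q * p \<noteq> p" "q * p \<noteq> q" "q * p \<noteq> 1"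
    using assms prime_gt_1_nat by auto
  then show "f (q * p) = g 1 + g p + g q + g (q * p)"
    using assms(4) by (subst fg) (auto simp: divisors_of_two_primes assms(2,3))
  have "{d. d dvd p} = {1, p}"
    using \<open>prime p\<close> by (auto simp: prime_nat_iff)
  then show "f p = g 1 + g p"
    using * by (subst fg) auto
qed

text \<open>
  The increasing enumeration of the primes above \<open>q\<close> supplies the subsequence. Taking only
  primes above \<open>q\<close> keeps the two factors distinct.
\<close>

lemma limit_pointI_prime_multiples:
  assumes "prime q"
    and lim: "\<And>r. strict_mono r \<Longrightarrow> (\<And>k. prime (r k) \<and> q < r k) \<Longrightarrow>
      (\<lambda>k. a (q * r k)) \<longlonglongrightarrow> L"
  shows "L \<in> limit_points a"
proof -
  have inf: "infinite {p. prime p \<and> q < p}"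
    unfolding infinite_nat_iff_unbounded
  proof
    fix m
    obtain p where "prime p" "max q m < p"
      using bigger_prime by blast
    then show "\<exists>n>m. n \<in> {p. prime p \<and> q < p}"
      by auto
  qed
  define r where "r = enumerate {p. prime p \<and> q < p}"
  have r: "strict_mono r" "\<And>k. prime (r k) \<and> q < r k"
    using strict_mono_enumerate [OF inf] enumerate_in_set [OF inf] by (auto simp: r_def)
  have "q > 0"
    using \<open>prime q\<close> prime_gt_0_nat by blast
  have "strict_mono (\<lambda>k. q * r k)"
    using r(1) \<open>q > 0\<close> by (simp add: strict_mono_def)
  moreover have "1 \<le> q * r k" for k
    using r(2) [of k] \<open>q > 0\<close> by (simp add: Suc_le_eq)
  ultimately show ?thesis
    using lim [OF r] by (auto simp: limit_points_def intro!: exI [of _ "\<lambda>k. q * r k"])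
qed

text \<open>
  The factor \<open>s\<close> is the sign with which the terms at \<open>p\<close> enter: \<open>1\<close> for a divisor sum and \<open>-1\<close>
  for its summands. Injectivity in \<open>q\<close> comes from strict monotonicity of \<open>q powr - \<alpha>\<close>.
\<close>

lemma infinite_limit_pointsI:
  assumes "C \<noteq> 0" "\<alpha> > 0"
    and "\<And>q. prime q \<Longrightarrow> C * (1 + s * real q powr - \<alpha>) \<in> limit_points a" and "s \<noteq> 0"
  shows "infinite (limit_points a)"
proof -
  have "inj_on (\<lambda>q. C * (1 + s * real q powr - \<alpha>)) {q. prime q}"
  proof (rule inj_onI)
    fix p q :: nat
    assume "p \<in> {q. prime q}" "q \<in> {q. prime q}"
      and eq: "C * (1 + s * real p powr - \<alpha>) = C * (1 + s * real q powr - \<alpha>)"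
    then have "real p > 0" "real q > 0"
      using prime_gt_0_nat by auto
    moreover have "real p powr - \<alpha> = real q powr - \<alpha>"
      using eq assms by simp
    ultimately show "p = q"
      using powr_less_mono2_neg [of "- \<alpha>" "real p" "real q"]
        powr_less_mono2_neg [of "- \<alpha>" "real q" "real p"] \<open>\<alpha> > 0\<close>
      by (cases p q rule: linorder_cases) auto
  qed
  then have "infinite ((\<lambda>q. C * (1 + s * real q powr - \<alpha>)) ` {q. prime q})"
    using primes_infinite finite_imageD by blast
  then show ?thesis
    by (rule infinite_super [rotated]) (use assms in auto)
qed

lemma tendsto_const_over_powr_prime_multiple:
  assumes "strict_mono (r :: nat \<Rightarrow> nat)" "\<alpha> > 0" "q > 0"
  shows "(\<lambda>k. c / real (q * r k) powr \<alpha>) \<longlonglongrightarrow> 0"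
proof -
  have "strict_mono (\<lambda>k. q * r k)"
    using assms by (simp add: strict_mono_def)
  then have "filterlim (\<lambda>k. real (q * r k)) at_top sequentially"
    by (intro filterlim_compose [OF filterlim_real_sequentially] filterlim_subseq)
  then have "(\<lambda>k. real (q * r k) powr - \<alpha>) \<longlonglongrightarrow> 0"
    using \<open>\<alpha> > 0\<close> by (intro tendsto_neg_powr) auto
  then have "(\<lambda>k. c * real (q * r k) powr - \<alpha>) \<longlonglongrightarrow> 0"
    by (rule tendsto_mult_right_zero)
  then show ?thesis
    by (simp only: powr_minus divide_inverse)
qed

text \<open>
  Subtracting \<open>f p = g 1 + g p\<close> from the four-term sum for \<open>f (q * p)\<close> eliminates \<open>g p\<close>, leaving
  \<open>g (q * p) = f (q * p) - f p - g q\<close>. The limit along these multiples is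
  \<open>C * (1 - q powr - \<alpha>)\<close>.
\<close>

lemma infinite_limit_points_summand:
  fixes f g :: "nat \<Rightarrow> nat"
  assumes fg: "\<And>n. n \<ge> 1 \<Longrightarrow> f n = (\<Sum>d | d dvd n. g d)" and "\<alpha> > 0" "C > 0"
    and lim: "(\<lambda>n. real (f n) / real n powr \<alpha>) \<longlonglongrightarrow> C"
  shows "infinite (limit_points (\<lambda>n. real (g n) / real n powr \<alpha>))"
proof (rule infinite_limit_pointsI)
  fix q :: nat assume q: "prime q"
  then have "q > 0"
    by (rule prime_gt_0_nat)
  show "C * (1 + - 1 * real q powr - \<alpha>) \<in> limit_points (\<lambda>n. real (g n) / real n powr \<alpha>)"
  proof (rule limit_pointI_prime_multiples [OF q])
    fix r :: "nat \<Rightarrow> nat"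
    assume r: "strict_mono r" "\<And>k. prime (r k) \<and> q < r k"
    have rq: "strict_mono (\<lambda>k. q * r k)"
      using r \<open>q > 0\<close> by (simp add: strict_mono_def)
    have ratio: "real (g (q * r k)) / real (q * r k) powr \<alpha> =
        real (f (q * r k)) / real (q * r k) powr \<alpha>
        - real (f (r k)) / real (r k) powr \<alpha> * real q powr - \<alpha>
        - real (g q) / real (q * r k) powr \<alpha>" for k
    proof -
      have "real (g (q * r k)) = real (f (q * r k)) - real (f (r k)) - real (g q)"
        using divisor_sum_two_primes [of f g "r k" q, OF fg] q r(2) [of k] by simp
      moreover have "real (f (r k)) / real (q * r k) powr \<alpha> =
          real (f (r k)) / real (r k) powr \<alpha> * real q powr - \<alpha>"
        by (simp add: powr_mult powr_minus divide_simps)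
      ultimately show ?thesis
        by (simp add: diff_divide_distrib)
    qed
    have "(\<lambda>k. real (f (q * r k)) / real (q * r k) powr \<alpha>
        - real (f (r k)) / real (r k) powr \<alpha> * real q powr - \<alpha>
        - real (g q) / real (q * r k) powr \<alpha>) \<longlonglongrightarrow> C - C * real q powr - \<alpha> - 0"
      using LIMSEQ_subseq_LIMSEQ [OF lim rq] LIMSEQ_subseq_LIMSEQ [OF lim r(1)]
      by (intro tendsto_diff tendsto_mult_right
          tendsto_const_over_powr_prime_multiple [OF r(1) \<open>\<alpha> > 0\<close> \<open>q > 0\<close>])
        (simp_all add: o_def)
    then show "(\<lambda>k. real (g (q * r k)) / real (q * r k) powr \<alpha>)
        \<longlonglongrightarrow> C * (1 + - 1 * real q powr - \<alpha>)"
      by (simp only: ratio) (simp add: right_diff_distrib distrib_left)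
  qed
qed (use assms in auto)

text \<open>
  In the four-term sum for \<open>f (q * p)\<close> the terms \<open>g (q * p)\<close> and \<open>g p\<close> have the
  growth of \<open>(q * p) powr \<alpha>\<close>, while \<open>g 1 + g q\<close> is constant. The limit along these multiples is
  \<open>C * (1 + q powr - \<alpha>)\<close>.
\<close>

lemma infinite_limit_points_divisor_sum:
  fixes f g :: "nat \<Rightarrow> nat"
  assumes fg: "\<And>n. n \<ge> 1 \<Longrightarrow> f n = (\<Sum>d | d dvd n. g d)" and "\<alpha> > 0" "C > 0"
    and lim: "(\<lambda>n. real (g n) / real n powr \<alpha>) \<longlonglongrightarrow> C"
  shows "infinite (limit_points (\<lambda>n. real (f n) / real n powr \<alpha>))"
proof (rule infinite_limit_pointsI)
  fix q :: nat assume q: "prime q"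
  then have "q > 0"
    by (rule prime_gt_0_nat)
  show "C * (1 + 1 * real q powr - \<alpha>) \<in> limit_points (\<lambda>n. real (f n) / real n powr \<alpha>)"
  proof (rule limit_pointI_prime_multiples [OF q])
    fix r :: "nat \<Rightarrow> nat"
    assume r: "strict_mono r" "\<And>k. prime (r k) \<and> q < r k"
    have rq: "strict_mono (\<lambda>k. q * r k)"
      using r \<open>q > 0\<close> by (simp add: strict_mono_def)
    have ratio: "real (f (q * r k)) / real (q * r k) powr \<alpha> =
        real (g (q * r k)) / real (q * r k) powr \<alpha>
        + real (g (r k)) / real (r k) powr \<alpha> * real q powr - \<alpha>
        + real (g 1 + g q) / real (q * r k) powr \<alpha>" for k
    proof -
      have "real (f (q * r k)) = real (g (q * r k)) + real (g (r k)) + real (g 1 + g q)"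
        using divisor_sum_two_primes [of f g "r k" q, OF fg] q r(2) [of k] by simp
      moreover have "real (g (r k)) / real (q * r k) powr \<alpha> =
          real (g (r k)) / real (r k) powr \<alpha> * real q powr - \<alpha>"
        by (simp add: powr_mult powr_minus divide_simps)
      ultimately show ?thesis
        by (simp add: add_divide_distrib)
    qed
    have "(\<lambda>k. real (g (q * r k)) / real (q * r k) powr \<alpha>
        + real (g (r k)) / real (r k) powr \<alpha> * real q powr - \<alpha>
        + real (g 1 + g q) / real (q * r k) powr \<alpha>) \<longlonglongrightarrow> C + C * real q powr - \<alpha> + 0"
      using LIMSEQ_subseq_LIMSEQ [OF lim rq] LIMSEQ_subseq_LIMSEQ [OF lim r(1)]
      by (intro tendsto_add tendsto_mult_right
          tendsto_const_over_powr_prime_multiple [OF r(1) \<open>\<alpha> > 0\<close> \<open>q > 0\<close>])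
        (simp_all add: o_def)
    then show "(\<lambda>k. real (f (q * r k)) / real (q * r k) powr \<alpha>)
        \<longlonglongrightarrow> C * (1 + 1 * real q powr - \<alpha>)"
      by (simp only: ratio) (simp add: right_diff_distrib distrib_left)
  qed
qed (use assms in auto)

section \<open>Growth of the two periodic point counts\<close>

lemma bounded_nonneg_seq_iff:
  fixes a :: "nat \<Rightarrow> real"
  assumes "\<And>n. a n \<ge> 0"
  shows "bounded {a n | n. n \<ge> 1} \<longleftrightarrow> (\<exists>B. \<forall>n\<ge>1. a n \<le> B)"
proof -
  have "bounded {a n | n. n \<ge> 1} \<longleftrightarrow> (\<exists>B. \<forall>n\<ge>1. \<bar>a n\<bar> \<le> B)"
    unfolding bounded_real by blast
  then show ?thesis
    using assms by simp
qed

theorem theorem4p3: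
  fixes X :: "'a set" and T :: "'a \<Rightarrow> 'a" and C \<alpha> :: real
  assumes "\<And>x. x \<in> X \<Longrightarrow> T x \<in> X"
    and "\<And>n. n \<ge> 1 \<Longrightarrow> finite (period_points X T n)"
    and "C > 0" and "\<alpha> > 0"
  shows
    "(\<alpha> > 1 \<longrightarrow>
        (bounded {real (num_least_period X T n) / real n powr \<alpha> | n. n \<ge> 1} \<longleftrightarrow>
         bounded {real (num_period X T n) / real n powr \<alpha> | n. n \<ge> 1})) \<and>
     (\<alpha> > 1 \<longrightarrow>
        ((\<lambda>n. real (num_period X T n) / real n powr \<alpha>) \<longlonglongrightarrow> 0 \<longleftrightarrow>
         (\<lambda>n. real (num_least_period X T n) / real n powr \<alpha>) \<longlonglongrightarrow> 0)) \<and>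
     (\<alpha> > 1 \<and> (\<lambda>n. real (num_period X T n) / real n powr \<alpha>) \<longlonglongrightarrow> C \<longrightarrow>
        infinite (limit_points (\<lambda>n. real (num_least_period X T n) / real n powr \<alpha>))) \<and>
     (\<alpha> \<ge> 1 \<and> (\<lambda>n. real (num_least_period X T n) / real n powr \<alpha>) \<longlonglongrightarrow> C \<longrightarrow>
        infinite (limit_points (\<lambda>n. real (num_period X T n) / real n powr \<alpha>)))"
proof -
  let ?f = "num_period X T" and ?g = "num_least_period X T"
  have fg: "?f n = (\<Sum>d | d dvd n. ?g d)" if "n \<ge> 1" for n
    using num_period_eq_sum_divisors assms(2) that by blast
  have g_le_f: "real (?g n) / real n powr \<alpha> \<le> real (?f n) / real n powr \<alpha>" if "n \<ge> 1" for n
    unfolding num_period_def num_least_period_def using assms(2) [OF that]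
    by (intro divide_right_mono) (auto intro: card_mono)
  have "(\<exists>B. \<forall>n\<ge>1. real (?g n) / real n powr \<alpha> \<le> B) \<longleftrightarrow>
      (\<exists>B. \<forall>n\<ge>1. real (?f n) / real n powr \<alpha> \<le> B)" if "\<alpha> > 1"
  proof
    assume "\<exists>B. \<forall>n\<ge>1. real (?g n) / real n powr \<alpha> \<le> B"
    then obtain B where B: "\<And>m. m \<ge> 1 \<Longrightarrow> real (?g m) / real m powr \<alpha> \<le> B"
      by auto
    have "0 \<le> real (?g 1) / real 1 powr \<alpha>"
      by simp
    also have "\<dots> \<le> B"
      by (rule B) simp
    finally have "B \<ge> 0" .
    have "real (?f n) / real n powr \<alpha> \<le> B * (\<Sum>e. real e powr - \<alpha>)" if "n \<ge> 1" for n
      by (rule divisor_sum_ratio_bound [of ?f n ?g, OF fg [OF that] that \<open>\<alpha> > 1\<close> B \<open>B \<ge> 0\<close>])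
    then show "\<exists>B. \<forall>n\<ge>1. real (?f n) / real n powr \<alpha> \<le> B"
      by blast
  next
    assume "\<exists>B. \<forall>n\<ge>1. real (?f n) / real n powr \<alpha> \<le> B"
    then show "\<exists>B. \<forall>n\<ge>1. real (?g n) / real n powr \<alpha> \<le> B"
      using g_le_f order_trans by meson
  qed
  then have "bounded {real (?g n) / real n powr \<alpha> | n. n \<ge> 1} \<longleftrightarrow>
      bounded {real (?f n) / real n powr \<alpha> | n. n \<ge> 1}" if "\<alpha> > 1"
    using that by (subst (1 2) bounded_nonneg_seq_iff) simp_all
  moreover have "(\<lambda>n. real (?g n) / real n powr \<alpha>) \<longlonglongrightarrow> 0"
    if "(\<lambda>n. real (?f n) / real n powr \<alpha>) \<longlonglongrightarrow> 0"
  proof (rule Lim_null_comparison [OF _ that])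
    show "eventually (\<lambda>n. norm (real (?g n) / real n powr \<alpha>) \<le> real (?f n) / real n powr \<alpha>)
        sequentially"
      using eventually_ge_at_top [of 1] by eventually_elim (use g_le_f in simp)
  qed
  moreover note divisor_sum_ratio_tendsto_0 [of ?f ?g \<alpha>, OF fg]
    infinite_limit_points_summand [of ?f ?g \<alpha> C, OF fg \<open>\<alpha> > 0\<close> \<open>C > 0\<close>]
    infinite_limit_points_divisor_sum [of ?f ?g \<alpha> C, OF fg \<open>\<alpha> > 0\<close> \<open>C > 0\<close>]
  ultimately show ?thesis
    by (intro conjI impI iffI) simp_all
qed

end
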